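(* Let $M$ and $N$ be matroids on disjoint finite sets $S$ and $T$, let $A\subseteq S$, $B\subseteq T$, and let $P$ be the principal sum $(M,N;A,B)$. For any sets $X\subseteq S$ and $Y\subseteq T$, the rank $r_P(X\cup Y)$ is the minimum of \[ r_M(X\cup A)+r_N(Y)\qquad\text{and}\qquad r_M(X)+r_N(Y-B)+|Y\cap B|.\]
   Context: For matroids $G$, $H$ on the same set $E$, the matroid union $G\vee H$ is the matroid on $E$ whose independent sets are the sets $I_G\cup I_H$ with $I_G$ independent in $G$, $I_H$ independent in $H$. Let $N_0=N\oplus U_{0,S}$ ($N$ with the elements of $S$ added as loops). For a matroid $K$ on $E$, $A\subseteq E$ and $b\notin E$, the principal extension $K+_Ab$ is the matroid on $E\cup b$ with rank $r(X)=r_K(X)$ and $r(X\cup b)=r_K(X)$ if $A\subseteq \mathrm{cl}_K(X)$, $r(X\cup b)=r_K(X)+1$ otherwise, for $X\subseteq E$. With $B=\{b_1,\dots,b_k\}$, let $M^+(A,B)=(((M+_Ab_1)+_Ab_2)\cdots+_Ab_k)\oplus U_{0,T-B}$; its rank function is $r(X\cup Y)=\min\{r_M(X\cup A),\,r_M(X)+|Y\cap B|\}$ for $X\subseteq S$, $Y\subseteq T$. The principal sum is $(M,N;A,B)=M^+(A,B)\vee N_0$. *)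

theory Defs
  imports Main
begin

record 'a set_system =
  ground :: "'a set"
  indep :: "'a set set"

locale matroid =
  fixes M :: "'a set_system"
  assumes finite_ground: "finite (ground M)"
    and indep_subset: "I \<in> indep M \<Longrightarrow> I \<subseteq> ground M"
    and indep_empty: "{} \<in> indep M"
    and indep_down: "I \<in> indep M \<Longrightarrow> J \<subseteq> I \<Longrightarrow> J \<in> indep M"
    and indep_augment:
      "I \<in> indep M \<Longrightarrow> J \<in> indep M \<Longrightarrow> card I < card J \<Longrightarrow>
        \<exists>e \<in> J - I. insert e I \<in> indep M"

definition rank :: "'a set_system \<Rightarrow> 'a set \<Rightarrow> nat" where
  "rank M X = Max (card ` {I \<in> indep M. I \<subseteq> X})"

definition cl :: "'a set_system \<Rightarrow> 'a set \<Rightarrow> 'a set" where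
  "cl M X = {e \<in> ground M. rank M (insert e X) = rank M X}"

text \<open>Only used for finite \<open>E\<close>, where \<open>card\<close> is the true cardinality.\<close>

definition uniform_matroid :: "nat \<Rightarrow> 'a set \<Rightarrow> 'a set_system" where
  "uniform_matroid k E = \<lparr>ground = E, indep = {I. I \<subseteq> E \<and> card I \<le> k}\<rparr>"

text \<open>Only used for set systems with disjoint ground sets.\<close>

definition direct_sum :: "'a set_system \<Rightarrow> 'a set_system \<Rightarrow> 'a set_system" where
  "direct_sum G H = \<lparr>ground = ground G \<union> ground H,
     indep = {I \<union> J | I J. I \<in> indep G \<and> J \<in> indep H}\<rparr>"

text \<open>Only used for set systems with the same ground set.\<close>

definition matroid_union :: "'a set_system \<Rightarrow> 'a set_system \<Rightarrow> 'a set_system" where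
  "matroid_union G H = \<lparr>ground = ground G,
     indep = {I \<union> J | I J. I \<in> indep G \<and> J \<in> indep H}\<rparr>"

text \<open>
  The principal extension is specified by its rank function. The matroid with a given rank
  function is the one whose independent sets are the sets with rank equal to cardinality;
  that this does give a matroid with the specified rank function is shown in
  \<open>matroid_principal_ext\<close> and \<open>rank_principal_ext\<close> below.
\<close>

definition principal_ext_rank :: "'a set_system \<Rightarrow> 'a set \<Rightarrow> 'a \<Rightarrow> 'a set \<Rightarrow> nat" where
  "principal_ext_rank K A b Z =
     (if b \<notin> Z \<or> A \<subseteq> cl K (Z - {b}) then rank K (Z - {b}) else rank K (Z - {b}) + 1)"

definition principal_ext :: "'a set_system \<Rightarrow> 'a set \<Rightarrow> 'a \<Rightarrow> 'a set_system" where
  "principal_ext K A b = \<lparr>ground = insert b (ground K),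
     indep = {Z. Z \<subseteq> insert b (ground K) \<and> principal_ext_rank K A b Z = card Z}\<rparr>"

text \<open>
  The set $B = \{b_1, \dots, b_k\}$ is given by an enumeration \<open>bs = [b\<^sub>1, \<dots>, b\<^sub>k]\<close> without
  repetition, in the order in which the points are added.
\<close>

definition extend_plus :: "'a set_system \<Rightarrow> 'a set \<Rightarrow> 'a list \<Rightarrow> 'a set \<Rightarrow> 'a set_system" where
  "extend_plus M A bs T =
     direct_sum (fold (\<lambda>b K. principal_ext K A b) bs M) (uniform_matroid 0 (T - set bs))"

definition principal_sum ::
  "'a set_system \<Rightarrow> 'a set_system \<Rightarrow> 'a set \<Rightarrow> 'a list \<Rightarrow> 'a set_system" where
  "principal_sum M N A bs =
     matroid_union (extend_plus M A bs (ground N)) (direct_sum N (uniform_matroid 0 (ground M)))"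

context matroid
begin

lemma finite_indep: "I \<in> indep M \<Longrightarrow> finite I"
  using finite_ground indep_subset finite_subset by blast

lemma finite_indep_sets: "finite {I \<in> indep M. I \<subseteq> X}"
  by (rule finite_subset[of _ "Pow (ground M)"]) (use indep_subset finite_ground in auto)

lemma card_le_rank: "I \<in> indep M \<Longrightarrow> I \<subseteq> X \<Longrightarrow> card I \<le> rank M X"
  unfolding rank_def using finite_indep_sets[of X] by (intro Max_ge) auto

lemma basis_exists: "\<exists>I \<in> indep M. I \<subseteq> X \<and> card I = rank M X"
proof -
  have "rank M X \<in> card ` {I \<in> indep M. I \<subseteq> X}"
    unfolding rank_def using finite_indep_sets[of X] indep_empty by (intro Max_in) auto
  then show ?thesis by auto
qed

lemma rank_mono: "X \<subseteq> Y \<Longrightarrow> rank M X \<le> rank M Y"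
proof -
  assume "X \<subseteq> Y"
  moreover obtain I where "I \<in> indep M" "I \<subseteq> X" "card I = rank M X" using basis_exists by blast
  ultimately show ?thesis using card_le_rank[of I Y] by auto
qed

lemma rank_indep: assumes "I \<in> indep M" shows "rank M I = card I"
proof -
  obtain J where "J \<subseteq> I" "card J = rank M I" using basis_exists by blast
  then show ?thesis
    using card_mono[OF finite_indep[OF assms], of J] card_le_rank[OF assms order_refl] by simp
qed

lemma indep_if_rank: assumes "finite Z" "rank M Z = card Z" shows "Z \<in> indep M"
proof -
  obtain I where "I \<in> indep M" "I \<subseteq> Z" "card I = rank M Z" using basis_exists by blast
  then show ?thesis using card_subset_eq[of Z I] assms by simp
qed

lemma not_subset_cl_indep:
  assumes I: "I \<in> indep M" and A: "A \<subseteq> ground M"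
  shows "\<not> A \<subseteq> cl M I \<longleftrightarrow> (\<exists>a \<in> A - I. insert a I \<in> indep M)"
proof
  assume "\<not> A \<subseteq> cl M I"
  then obtain a where a: "a \<in> A" "rank M (insert a I) \<noteq> rank M I" using A by (auto simp: cl_def)
  then have aI: "a \<notin> I" by (auto simp: insert_absorb)
  obtain J where J: "J \<in> indep M" "J \<subseteq> insert a I" "card J = rank M (insert a I)"
    using basis_exists by blast
  have "rank M (insert a I) > card I"
    using a rank_mono[of I "insert a I"] rank_indep[OF I] by fastforce
  then have "J = insert a I"
    using J aI finite_indep[OF I] by (intro card_seteq) auto
  then show "\<exists>a \<in> A - I. insert a I \<in> indep M" using J a aI by blast
next
  assume "\<exists>a \<in> A - I. insert a I \<in> indep M"
  then obtain a where a: "a \<in> A" "a \<notin> I" "insert a I \<in> indep M" by blast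
  then have "rank M (insert a I) = card I + 1"
    using rank_indep finite_indep[OF I] by simp
  then show "\<not> A \<subseteq> cl M I" using a rank_indep[OF I] by (auto simp: cl_def)
qed

lemma cl_basis: assumes "I \<subseteq> X" "rank M I = rank M X" shows "cl M X \<subseteq> cl M I"
proof
  fix e assume e: "e \<in> cl M X"
  then have "rank M (insert e I) \<le> rank M I"
    using assms rank_mono[of "insert e I" "insert e X"] by (auto simp: cl_def)
  then show "e \<in> cl M I" using e rank_mono[OF subset_insertI, of I e] by (auto simp: cl_def)
qed

lemma basis_extend:
  assumes "I \<in> indep M" "I \<subseteq> X"
  shows "\<exists>J \<in> indep M. I \<subseteq> J \<and> J \<subseteq> X \<and> card J = rank M X"
  using assms
proof (induction "rank M X - card I" arbitrary: I)
  case 0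
  then show ?case using card_le_rank[of I X] by (intro bexI[of _ I]) simp_all
next
  case (Suc n)
  obtain J where J: "J \<in> indep M" "J \<subseteq> X" "card J = rank M X" using basis_exists by blast
  have "card I < card J" using Suc.hyps(2) J(3) by linarith
  then obtain e where e: "e \<in> J - I" "insert e I \<in> indep M"
    using indep_augment[OF Suc.prems(1) J(1)] by blast
  have "n = rank M X - card (insert e I)"
    using e(1) Suc.hyps(2) card_insert_disjoint[OF finite_indep[OF Suc.prems(1)], of e] by auto
  moreover have "insert e I \<subseteq> X" using e J Suc.prems by blast
  ultimately obtain K where "K \<in> indep M" "insert e I \<subseteq> K" "K \<subseteq> X" "card K = rank M X"
    using Suc.hyps(1)[OF _ e(2)] by blast
  then show ?case by blast
qed

lemma cl_mono: assumes "X \<subseteq> Y" shows "cl M X \<subseteq> cl M Y"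
proof
  fix e assume e: "e \<in> cl M X"
  show "e \<in> cl M Y"
  proof (rule ccontr)
    assume "e \<notin> cl M Y"
    then have neq: "rank M (insert e Y) \<noteq> rank M Y" using e by (auto simp: cl_def)
    then have lt: "rank M Y < rank M (insert e Y)"
      using rank_mono[OF subset_insertI, of Y e] by auto
    obtain I where I: "I \<in> indep M" "I \<subseteq> X" "card I = rank M X" using basis_exists by blast
    obtain J where J: "J \<in> indep M" "I \<subseteq> J" "J \<subseteq> Y" "card J = rank M Y"
      using basis_extend[of I Y] I assms by blast
    obtain L where L: "L \<in> indep M" "J \<subseteq> L" "L \<subseteq> insert e Y" "card L = rank M (insert e Y)"
      using basis_extend[of J "insert e Y"] J by blast
    have "e \<in> L" using L lt card_le_rank[of L Y] by (cases "L \<subseteq> Y") auto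
    moreover have "e \<notin> X" using neq assms by (auto simp: insert_absorb)
    ultimately have "insert e I \<in> indep M" "e \<notin> I" using L J I indep_down[of L] by auto
    then have "card I + 1 \<le> rank M (insert e X)"
      using card_le_rank[of "insert e I" "insert e X"] I finite_indep[OF I(1)] by auto
    then show False using e I by (simp add: cl_def)
  qed
qed

lemma indep_principal_ext:
  assumes A: "A \<subseteq> ground M" and b: "b \<notin> ground M"
  shows "Z \<in> indep (principal_ext M A b) \<longleftrightarrow>
    (if b \<in> Z then Z - {b} \<in> indep M \<and> (\<exists>a \<in> A - Z. insert a (Z - {b}) \<in> indep M)
     else Z \<in> indep M)"
proof (cases "finite Z")
  case False
  have "Z \<notin> indep M" "Z - {b} \<notin> indep M" using False finite_indep[of Z] finite_indep[of "Z - {b}"] by auto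
  moreover have "\<not> Z \<subseteq> insert b (ground M)"
    using False finite_ground finite_subset by blast
  ultimately show ?thesis by (auto simp: principal_ext_def)
next
  case fin: True
  show ?thesis
  proof (cases "b \<in> Z")
    case False
    then show ?thesis using fin indep_if_rank[of Z] rank_indep[of Z] indep_subset[of Z]
      by (auto simp: principal_ext_def principal_ext_rank_def)
  next
    case True
    define I where "I = Z - {b}"
    have Z: "Z = insert b I" "b \<notin> I" "finite I" "card Z = card I + 1"
      using True fin card_Suc_Diff1[OF fin True] by (auto simp: I_def)
    have le: "rank M I \<le> card I"
    proof -
      obtain J where "J \<subseteq> I" "card J = rank M I" using basis_exists by blast
      then show ?thesis using card_mono[OF Z(3), of J] by simp
    qed
    have ext: "principal_ext_rank M A b Z = card Z \<longleftrightarrow> \<not> A \<subseteq> cl M I \<and> rank M I = card I"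
      unfolding principal_ext_rank_def I_def[symmetric] Z(4) using le True by simp
    have A': "A - Z = A - I" using A b Z by auto
    have "principal_ext_rank M A b Z = card Z \<longleftrightarrow>
        I \<in> indep M \<and> (\<exists>a \<in> A - Z. insert a I \<in> indep M)"
      unfolding ext A' using indep_if_rank[OF Z(3)] rank_indep[of I] not_subset_cl_indep[of I A] A
      by blast
    moreover have "I \<in> indep M \<Longrightarrow> Z \<subseteq> insert b (ground M)"
      using indep_subset[of I] Z by auto
    ultimately show ?thesis unfolding principal_ext_def I_def[symmetric] using True by simp blast
  qed
qed

lemma matroid_principal_ext:
  assumes A: "A \<subseteq> ground M" and b: "b \<notin> ground M"
  shows "matroid (principal_ext M A b)"
proof
  note iff = indep_principal_ext[OF A b]
  show "finite (ground (principal_ext M A b))"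
    using finite_ground by (simp add: principal_ext_def)
  show "I \<subseteq> ground (principal_ext M A b)" if "I \<in> indep (principal_ext M A b)" for I
    using that by (simp add: principal_ext_def)
  show "{} \<in> indep (principal_ext M A b)"
    using indep_empty by (simp add: iff)
  show "J \<in> indep (principal_ext M A b)" if I: "I \<in> indep (principal_ext M A b)" and J: "J \<subseteq> I" for I J
  proof (cases "b \<in> I")
    case False
    then show ?thesis using I J indep_down[of I J] by (auto simp: iff)
  next
    case True
    then obtain a where a: "a \<in> A - I" "I - {b} \<in> indep M" "insert a (I - {b}) \<in> indep M"
      using I by (auto simp: iff)
    have "J - {b} \<in> indep M" using indep_down[OF a(2), of "J - {b}"] J by blast
    moreover have "insert a (J - {b}) \<in> indep M"
      using indep_down[OF a(3), of "insert a (J - {b})"] J by blast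
    moreover have "a \<in> A - J" using a J by blast
    moreover have "b \<notin> J \<Longrightarrow> J - {b} = J" by simp
    ultimately show ?thesis unfolding iff by (cases "b \<in> J") (simp, blast, simp)
  qed
  show "\<exists>e \<in> Z' - Z. insert e Z \<in> indep (principal_ext M A b)"
    if Z: "Z \<in> indep (principal_ext M A b)" and Z': "Z' \<in> indep (principal_ext M A b)"
      and lt: "card Z < card Z'" for Z Z'
  proof -
    have fin: "finite Z" "finite Z'"
      using Z Z' finite_ground by (auto simp: principal_ext_def intro: finite_subset)
    define I J where "I = Z - {b}" and "J = Z' - {b}"
    have IJ: "I \<in> indep M" "J \<in> indep M" "b \<notin> I" "b \<notin> J"
      using Z Z' by (auto simp: iff I_def J_def split: if_splits)
    have bA: "b \<notin> A" using A b by auto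
    have f: "finite I" "finite J" using fin by (auto simp: I_def J_def)
    have cZ: "card Z = card I + (if b \<in> Z then 1 else 0)"
      using card_Suc_Diff1[OF fin(1), of b] by (simp add: I_def)
    have cZ': "card Z' = card J + (if b \<in> Z' then 1 else 0)"
      using card_Suc_Diff1[OF fin(2), of b] by (simp add: J_def)
    have ex: "\<exists>a \<in> A - I. insert a I \<in> indep M" if "b \<in> Z"
      using Z that by (auto simp: iff I_def)
    have ex': "\<exists>a \<in> A - J. insert a J \<in> indep M" if "b \<in> Z'"
      using Z' that by (auto simp: iff J_def)
    have nob: "\<exists>e \<in> Z' - Z. insert e Z \<in> indep (principal_ext M A b)"
      if "b \<notin> Z" "e \<in> J - I" "insert e I \<in> indep M" for e
      using that IJ by (intro bexI[of _ e]) (auto simp: iff I_def J_def)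
    have withb: "\<exists>e \<in> Z' - Z. insert e Z \<in> indep (principal_ext M A b)"
      if "b \<in> Z" "e \<in> J - I" "a \<in> A" "a \<notin> I" "a \<noteq> e" "insert a (insert e I) \<in> indep M" for e a
    proof -
      have "insert e I \<in> indep M" using indep_down[OF that(6)] by auto
      moreover have "insert e Z - {b} = insert e I" using that IJ by (auto simp: I_def)
      moreover have "a \<in> A - insert e Z" using that bA by (auto simp: I_def)
      ultimately have "insert e Z \<in> indep (principal_ext M A b)"
        using that(1,6) by (auto simp: iff)
      moreover have "e \<in> Z' - Z" using that IJ by (auto simp: I_def J_def)
      ultimately show ?thesis by blast
    qed
    consider "b \<notin> Z" "b \<notin> Z'" | "b \<notin> Z" "b \<in> Z'" | "b \<in> Z" "b \<notin> Z'" | "b \<in> Z" "b \<in> Z'" by blast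
    then show ?thesis
    proof cases
      case 1
      then show ?thesis using indep_augment[OF IJ(1,2)] lt cZ cZ' nob by auto
    next
      case 2
      then obtain a where a: "a \<in> A - J" "insert a J \<in> indep M" using ex' by blast
      have "card I < card (insert a J)" using lt cZ cZ' 2 a f by auto
      then obtain e where e: "e \<in> insert a J - I" "insert e I \<in> indep M"
        using indep_augment[OF IJ(1) a(2)] by blast
      show ?thesis
      proof (cases "e = a")
        case True
        then have "insert b Z \<in> indep (principal_ext M A b)"
          using 2 IJ e a bA by (auto simp: iff I_def)
        then show ?thesis using 2 by blast
      next
        case False
        then show ?thesis using nob 2 e by blast
      qed
    next
      case 3
      then obtain a where a: "a \<in> A - I" "insert a I \<in> indep M" using ex by blast
      have "card (insert a I) < card J" using lt cZ cZ' 3 a f by auto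
      then obtain e where e: "e \<in> J - insert a I" "insert e (insert a I) \<in> indep M"
        using indep_augment[OF a(2) IJ(2)] by blast
      then show ?thesis using withb[of e a] 3 a by (auto simp: insert_commute)
    next
      case 4
      then obtain a where a: "a \<in> A - I" "insert a I \<in> indep M" using ex by blast
      obtain c where c: "c \<in> A - J" "insert c J \<in> indep M" using ex' 4 by blast
      have ltIJ: "card I < card J" using lt cZ cZ' 4 by auto
      then have "card (insert a I) < card (insert c J)" using a c f by auto
      then obtain e where e: "e \<in> insert c J - insert a I" "insert e (insert a I) \<in> indep M"
        using indep_augment[OF a(2) c(2)] by blast
      show ?thesis
      proof (cases "e \<in> J")
        case True
        then show ?thesis using withb[of e a] 4 a e by (auto simp: insert_commute)
      next
        case False
        then have ec: "e = c" using e by auto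
        obtain d where d: "d \<in> J - I" "insert d I \<in> indep M"
          using indep_augment[OF IJ(1,2) ltIJ] by blast
        have "card (insert d I) < card (insert e (insert a I))" using e a d f by auto
        then obtain g where g: "g \<in> insert e (insert a I) - insert d I" "insert g (insert d I) \<in> indep M"
          using indep_augment[OF d(2) e(2)] by blast
        then show ?thesis using withb[of d g] 4 d a c ec by auto
      qed
    qed
  qed
qed

lemma rank_principal_ext:
  assumes A: "A \<subseteq> ground M" and b: "b \<notin> ground M" and X: "X \<subseteq> ground M"
  shows "rank (principal_ext M A b) X = rank M X"
    and "rank (principal_ext M A b) (insert b X) =
      (if A \<subseteq> cl M X then rank M X else rank M X + 1)"
proof -
  note iff = indep_principal_ext[OF A b]
  interpret P: matroid "principal_ext M A b" by (rule matroid_principal_ext[OF A b])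
  have bX: "b \<notin> X" using b X by auto
  have "{I \<in> indep (principal_ext M A b). I \<subseteq> X} = {I \<in> indep M. I \<subseteq> X}"
    using bX by (auto simp: iff)
  then show 1: "rank (principal_ext M A b) X = rank M X" by (simp add: rank_def)
  obtain I where I: "I \<in> indep M" "I \<subseteq> X" "card I = rank M X" using basis_exists by blast
  obtain Z where Z: "Z \<in> indep (principal_ext M A b)" "Z \<subseteq> insert b X"
    "card Z = rank (principal_ext M A b) (insert b X)" using P.basis_exists by blast
  have ge: "rank M X \<le> rank (principal_ext M A b) (insert b X)"
    using P.rank_mono[of X "insert b X"] 1 by auto
  have JM: "Z - {b} \<in> indep M" using Z by (auto simp: iff split: if_splits)
  have J: "card (Z - {b}) \<le> rank M X" using card_le_rank[OF JM] Z by auto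
  have cZ: "card Z = card (Z - {b}) + (if b \<in> Z then 1 else 0)"
    using card_Suc_Diff1[OF P.finite_indep[OF Z(1)], of b] by simp
  show "rank (principal_ext M A b) (insert b X) =
      (if A \<subseteq> cl M X then rank M X else rank M X + 1)"
  proof (cases "A \<subseteq> cl M X")
    case True
    have "card Z \<le> rank M X"
    proof (rule ccontr)
      assume "\<not> ?thesis"
      then have bZ: "b \<in> Z" and eq: "card (Z - {b}) = rank M X"
        using cZ J by (auto split: if_splits)
      have "cl M X \<subseteq> cl M (Z - {b})"
        using cl_basis[of "Z - {b}" X] Z(2) eq rank_indep[OF JM] by auto
      then have "\<not> (\<exists>a \<in> A - (Z - {b}). insert a (Z - {b}) \<in> indep M)"
        using not_subset_cl_indep[OF JM A] True by blast
      moreover have "\<exists>a \<in> A - Z. insert a (Z - {b}) \<in> indep M"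
        using Z(1) bZ by (simp add: iff)
      ultimately show False by blast
    qed
    then show ?thesis using True Z(3) ge by auto
  next
    case False
    then have "\<not> A \<subseteq> cl M I" using cl_mono[OF I(2)] by blast
    then obtain a where "a \<in> A - I" "insert a I \<in> indep M"
      using not_subset_cl_indep[OF I(1) A] by blast
    moreover have "b \<notin> I" "b \<notin> A" using A b bX I by auto
    ultimately have "insert b I \<in> indep (principal_ext M A b)" using I by (auto simp: iff)
    then have "card (insert b I) \<le> rank (principal_ext M A b) (insert b X)"
      using P.card_le_rank I by blast
    then show ?thesis
      using False Z(3) cZ J I finite_indep[OF I(1)] \<open>b \<notin> I\<close> by (auto split: if_splits)
  qed
qed

end

end

(*
  A set Z is independent in M\<^sup>+(A,B) iff Z - B is independent in M and |Z| does not exceed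
  r_M((Z - B) \<union> A). Hence r_P(X \<union> Y) is the largest size of I \<union> J \<union> K with I \<subseteq> X, J \<subseteq> Y \<inter> B,
  K \<subseteq> Y, K independent in N and I \<union> J independent in M\<^sup>+(A,B). Both upper bounds are immediate.
  They are attained by taking I a basis of X, K a basis of Y containing a basis of Y - B, and
  J \<subseteq> (Y \<inter> B) - K as large as the bound r_M(X \<union> A) - r_M(X) permits.
*)
theory Submission
  imports Defs
begin

context matroid
begin

text \<open>\<open>R \<inter> X\<close> is itself an independent subset of \<open>X\<close>, so it
  cannot outgrow the basis \<open>I\<close> that it contains.\<close>

lemma basis_Int:
  assumes "I \<in> indep M" "I \<subseteq> X" "card I = rank M X" "R \<in> indep M" "I \<subseteq> R"
  shows "R \<inter> X = I"
proof -
  have "R \<inter> X \<in> indep M" using indep_down[OF assms(4)] by blast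
  then have "card (R \<inter> X) \<le> card I" "finite (R \<inter> X)"
    using card_le_rank[of "R \<inter> X" X] assms(3) finite_indep by auto
  moreover have "I \<subseteq> R \<inter> X" using assms by blast
  ultimately show ?thesis using card_seteq[of "R \<inter> X" I] by auto
qed

text \<open>Extend \<open>I\<close> to a basis \<open>R\<close> of \<open>X \<union> A\<close>. By
  \<open>basis_Int\<close> it gains no further element of \<open>X\<close>, so it stays within
  \<open>I \<union> A\<close>.\<close>

lemma rank_basis_Un:
  assumes I: "I \<in> indep M" "I \<subseteq> X" "card I = rank M X"
  shows "rank M (I \<union> A) = rank M (X \<union> A)"
proof -
  obtain R where R: "R \<in> indep M" "I \<subseteq> R" "R \<subseteq> X \<union> A" "card R = rank M (X \<union> A)"
    using basis_extend[of I "X \<union> A"] I by blast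
  have "R \<subseteq> I \<union> A" using basis_Int[OF I R(1,2)] R(3) by blast
  then have "rank M (X \<union> A) \<le> rank M (I \<union> A)" using card_le_rank R by metis
  moreover have "rank M (I \<union> A) \<le> rank M (X \<union> A)" using I(2) by (intro rank_mono) blast
  ultimately show ?thesis by simp
qed

text \<open>Turns the exchange condition of \<open>indep_principal_ext\<close> into an inequality,
  the form that can be iterated over several added points.\<close>

lemma augment_from_iff:
  assumes I: "I \<in> indep M"
  shows "(\<exists>a \<in> A - I. insert a I \<in> indep M) \<longleftrightarrow> card I < rank M (I \<union> A)"
proof
  assume "\<exists>a \<in> A - I. insert a I \<in> indep M"
  then obtain a where a: "a \<in> A - I" "insert a I \<in> indep M" by blast
  then have "card (insert a I) \<le> rank M (I \<union> A)" by (intro card_le_rank) auto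
  then show "card I < rank M (I \<union> A)" using a finite_indep[OF I] by simp
next
  assume lt: "card I < rank M (I \<union> A)"
  obtain J where J: "J \<in> indep M" "J \<subseteq> I \<union> A" "card J = rank M (I \<union> A)"
    using basis_exists by blast
  then show "\<exists>a \<in> A - I. insert a I \<in> indep M" using indep_augment[OF I J(1)] lt by auto
qed

end

text \<open>Induction for arbitrary \<open>M\<close>, because \<open>fold\<close> adds the first
  point to \<open>M\<close> itself and the hypothesis is then used for
  \<open>principal_ext M A b\<close>. Since \<open>A\<close> is part of the set whose rank is taken,
  \<open>b\<close> does not change that rank, and the added points enter only through their
  number.\<close>

lemma indep_fold_principal_ext:
  assumes "matroid M" "A \<subseteq> ground M" "set bs \<inter> ground M = {}" "distinct bs"
  shows "Z \<in> indep (fold (\<lambda>b K. principal_ext K A b) bs M) \<longleftrightarrow>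
    Z - set bs \<in> indep M \<and> card Z \<le> rank M (Z - set bs \<union> A)"
  using assms
proof (induction bs arbitrary: M)
  case Nil
  interpret matroid M by fact
  show ?case using card_le_rank[of Z "Z \<union> A"] by auto
next
  case (Cons b bs)
  interpret matroid M by fact
  let ?M = "principal_ext M A b"
  have A: "A \<subseteq> ground M" and b: "b \<notin> ground M" using Cons.prems by auto
  have gr: "ground ?M = insert b (ground M)" by (simp add: principal_ext_def)
  have IH: "Z \<in> indep (fold (\<lambda>b K. principal_ext K A b) (b # bs) M) \<longleftrightarrow>
      Z - set bs \<in> indep ?M \<and> card Z \<le> rank ?M (Z - set bs \<union> A)"
    using Cons.IH[OF matroid_principal_ext[OF A b]] Cons.prems gr by auto
  define I where "I = Z - set (b # bs)"
  have bI: "b \<notin> I" by (simp add: I_def)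
  have bA: "b \<notin> A" using A b by auto
  show ?case
  proof (cases "b \<in> Z")
    case False
    then have W: "Z - set bs = I" by (auto simp: I_def)
    have "I \<in> indep M \<Longrightarrow> rank ?M (I \<union> A) = rank M (I \<union> A)"
      using rank_principal_ext(1)[OF A b] indep_subset A by simp
    then show ?thesis
      unfolding IH W I_def[symmetric] using indep_principal_ext[OF A b, of I] bI by auto
  next
    case True
    then have W: "Z - set bs = insert b I" using Cons.prems by (auto simp: I_def)
    have ind: "insert b I \<in> indep ?M \<longleftrightarrow> I \<in> indep M \<and> card I < rank M (I \<union> A)"
    proof -
      have "A - insert b I = A - I" "insert b I - {b} = I" using bA bI by auto
      then show ?thesis
        using indep_principal_ext[OF A b, of "insert b I"] augment_from_iff[of I A] by auto
    qed
    have rk: "rank ?M (insert b I \<union> A) = rank M (I \<union> A)" if "I \<in> indep M"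
    proof -
      have "A \<subseteq> cl M (I \<union> A)" using A by (auto simp: cl_def insert_absorb)
      then show ?thesis
        using rank_principal_ext(2)[OF A b, of "I \<union> A"] indep_subset[OF that] A by simp
    qed
    \<comment> \<open>With this, the bound on \<open>card Z\<close> already implies the strict
      inequality in \<open>ind\<close>.\<close>
    have "card I < card Z" if "I \<in> indep M"
    proof -
      have "finite Z" using finite_indep[OF that] by (simp add: I_def)
      moreover have "I \<subset> Z" using True by (auto simp: I_def)
      ultimately show ?thesis by (rule psubset_card_mono)
    qed
    then show ?thesis unfolding IH W I_def[symmetric] using ind rk by auto
  qed
qed

text \<open>Infinite sets have \<open>card\<close> 0 too; finiteness of \<open>E\<close> leaves only
  the empty set independent among the loops.\<close>

lemma indep_direct_sum_loops:
  assumes "finite E"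
  shows "indep (direct_sum G (uniform_matroid 0 E)) = indep G"
proof -
  have "indep (uniform_matroid 0 E) = {{}}"
    using assms by (auto simp: uniform_matroid_def dest: finite_subset)
  then show ?thesis by (simp add: direct_sum_def)
qed

theorem theorem3p5:
  fixes M N P :: "'a set_system" and S T A B X Y :: "'a set" and bs :: "'a list"
  assumes "matroid M" and "matroid N"
    and "ground M = S" and "ground N = T" and "S \<inter> T = {}"
    and "A \<subseteq> S" and "B \<subseteq> T"
    and "set bs = B" and "distinct bs"
    and "P = principal_sum M N A bs"
    and "X \<subseteq> S" and "Y \<subseteq> T"
  shows "rank P (X \<union> Y) =
    min (rank M (X \<union> A) + rank N Y) (rank M X + rank N (Y - B) + card (Y \<inter> B))"
proof -
  interpret M: matroid M by fact
  interpret N: matroid N by fact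
  have disj: "X \<inter> B = {}" "X \<inter> Y = {}" "set bs \<inter> ground M = {}" using assms by auto
  have fin: "finite S" "finite T" "finite X" "finite Y"
    using M.finite_ground N.finite_ground assms finite_subset by auto
  define F where "F = fold (\<lambda>b K. principal_ext K A b) bs M"
  have F: "Z \<in> indep F \<longleftrightarrow> Z - B \<in> indep M \<and> card Z \<le> rank M (Z - B \<union> A)" for Z
    unfolding F_def using indep_fold_principal_ext[of M A bs Z] assms disj by simp
  have P: "indep P = {G \<union> K | G K. G \<in> indep F \<and> K \<in> indep N}"
    unfolding \<open>P = principal_sum M N A bs\<close> principal_sum_def extend_plus_def matroid_union_def F_def
      indep_direct_sum_loops[OF M.finite_ground] indep_direct_sum_loops[OF finite_Diff[OF N.finite_ground]]
    by simp
  let ?m = "min (rank M (X \<union> A) + rank N Y) (rank M X + rank N (Y - B) + card (Y \<inter> B))"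
  have upper: "card Z \<le> ?m" if ZP: "Z \<in> indep P" and ZXY: "Z \<subseteq> X \<union> Y" for Z
  proof -
    obtain G K where Z: "Z = G \<union> K" and "G \<in> indep F" and K: "K \<in> indep N"
      using ZP unfolding P by blast
    then have G: "G - B \<in> indep M" "card G \<le> rank M (G - B \<union> A)" by (simp_all add: F)
    have "K \<subseteq> T" "G - B \<subseteq> S" using N.indep_subset[OF K] M.indep_subset[OF G(1)] assms by simp_all
    then have KY: "K \<subseteq> Y" and GX: "G - B \<subseteq> X"
      using ZXY Z \<open>S \<inter> T = {}\<close> \<open>X \<subseteq> S\<close> \<open>Y \<subseteq> T\<close> by blast+
    have "card Z \<le> card G + card K" unfolding Z by (rule card_Un_le)
    moreover have "card G \<le> rank M (X \<union> A)"
      using G(2) M.rank_mono[of "G - B \<union> A" "X \<union> A"] GX by fastforce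
    moreover have "card K \<le> rank N Y" by (rule N.card_le_rank[OF K KY])
    ultimately have 1: "card Z \<le> rank M (X \<union> A) + rank N Y" by linarith
    \<comment> \<open>For the second bound, split \<open>Z\<close> along \<open>B\<close>: as
      \<open>X\<close> misses \<open>B\<close>, the part inside \<open>B\<close> lies in
      \<open>Y \<inter> B\<close>.\<close>
    have "Z \<subseteq> (G - B) \<union> (K - B) \<union> (Y \<inter> B)" using ZXY Z disj KY by blast
    moreover have "finite ((G - B) \<union> (K - B) \<union> (Y \<inter> B))"
      using M.finite_indep[OF G(1)] N.finite_indep[OF K] fin by simp
    ultimately have "card Z \<le> card ((G - B) \<union> (K - B) \<union> (Y \<inter> B))" by (intro card_mono)
    also have "\<dots> \<le> card (G - B) + card (K - B) + card (Y \<inter> B)"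
      by (meson add_le_mono1 card_Un_le order_trans)
    also have "\<dots> \<le> rank M X + rank N (Y - B) + card (Y \<inter> B)"
      using M.card_le_rank[OF G(1) GX] N.card_le_rank[OF N.indep_down[OF K], of "K - B" "Y - B"] KY
      by (intro add_mono) auto
    finally show ?thesis using 1 by simp
  qed
  have lower: "\<exists>Z \<in> indep P. Z \<subseteq> X \<union> Y \<and> card Z = ?m"
  proof -
    obtain I where I: "I \<in> indep M" "I \<subseteq> X" "card I = rank M X" using M.basis_exists by blast
    obtain L where L: "L \<in> indep N" "L \<subseteq> Y - B" "card L = rank N (Y - B)"
      using N.basis_exists by blast
    obtain K where K: "K \<in> indep N" "L \<subseteq> K" "K \<subseteq> Y" "card K = rank N Y"
      using N.basis_extend[of L Y] L by blast
    have fK: "finite K" by (rule N.finite_indep[OF K(1)])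
    have KL: "K - B = L" using N.basis_Int[OF L K(1,2)] K(3) by blast
    have cK: "card K = card L + card (K \<inter> B)"
      using card_Int_Diff[OF fK, of B] KL by simp
    have "Y \<inter> B \<inter> K = K \<inter> B" using K(3) by blast
    then have cYB: "card (Y \<inter> B - K) + card (K \<inter> B) = card (Y \<inter> B)"
      using card_Int_Diff[of "Y \<inter> B" K] fin by simp
    \<comment> \<open>The second term is the room that \<open>F\<close> leaves above
      \<open>card I = rank M X\<close>; by \<open>le\<close> below, the subtraction is not
      truncated.\<close>
    let ?n = "min (card (Y \<inter> B - K)) (rank M (X \<union> A) - rank M X)"
    obtain J where J: "J \<subseteq> Y \<inter> B - K" "card J = ?n" "finite J"
      using obtain_subset_with_card_n[of ?n "Y \<inter> B - K"] by auto
    have le: "rank M X \<le> rank M (X \<union> A)" by (rule M.rank_mono) simp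
    have IJB: "I \<union> J - B = I" using I(2) J(1) disj by blast
    have "I \<inter> J = {}" using I(2) J(1) disj by blast
    then have cIJ: "card (I \<union> J) = rank M X + ?n"
      using card_Un_disjoint[OF M.finite_indep[OF I(1)] J(3)] I(3) J(2) by simp
    then have "I \<union> J \<in> indep F"
      unfolding F IJB M.rank_basis_Un[OF I] using I(1) le by simp
    then have "I \<union> J \<union> K \<in> indep P" unfolding P using K(1) by blast
    moreover have "I \<union> J \<union> K \<subseteq> X \<union> Y" using I J K by blast
    moreover have "(I \<union> J) \<inter> K = {}" using I(2) J(1) K(3) disj by blast
    then have "card (I \<union> J \<union> K) = rank M X + ?n + rank N Y"
      using card_Un_disjoint[of "I \<union> J" K] cIJ M.finite_indep[OF I(1)] J(3) fK K(4) by simp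
    \<comment> \<open>If the room limits \<open>?n\<close>, the total is the first term of
      \<open>?m\<close>. Otherwise \<open>J\<close> is all of \<open>Y \<inter> B - K\<close>, and
      \<open>cK\<close> with \<open>cYB\<close> turns the total into the second term.\<close>
    then have "card (I \<union> J \<union> K) = ?m" using cK cYB le K(4) L(3) by linarith
    ultimately show ?thesis by blast
  qed
  have "finite {Z \<in> indep P. Z \<subseteq> X \<union> Y}"
    by (rule finite_subset[of _ "Pow (X \<union> Y)"]) (use fin in auto)
  moreover obtain Z where "Z \<in> indep P" "Z \<subseteq> X \<union> Y" "card Z = ?m" using lower by blast
  then have "?m \<in> card ` {Z \<in> indep P. Z \<subseteq> X \<union> Y}" by (intro image_eqI[of _ _ Z]) simp_all
  ultimately show ?thesis unfolding rank_def[of P] using upper by (intro Max_eqI) blast+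
qed

end
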